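(* For any $d\in2^{<\omega}$, $s\in\prod_{n<|d|}b(n)$ and $k<\omega$, the set $Q_{d,s,k}\subseteq\mathbb{LE}_b$ is centered. In particular, $\mathbb{LE}_b$ is $\sigma$-centered.
   Context: Fix $b\in\omega^\omega$ with $b(n)\geq2^n$ for all $n<\omega$. The poset $\mathbb{LE}_b$: conditions are triples $(d,s,\varphi)$ with $d\in2^{<\omega}$, $s\in\prod_{n<|d|}b(n)$, $\varphi\in\prod_{n<\omega}\mathcal P(b(n))$ such that for some $k<\omega$, $\frac{|\varphi(n)|}{b(n)}\leq 2^{-n/2^k}$ for all $n\geq|d|$. The order is: $(d',s',\varphi')\leq(d,s,\varphi)$ if $d'\supseteq d$, $s'\supseteq s$, $\varphi'(n)\supseteq\varphi(n)$ for all $n<\omega$, and $s'(n)\notin\varphi(n)$ for all $n\in(d')^{-1}(\{1\})\setminus d^{-1}(\{1\})$. $Q_{d,s,k}$ is the set of conditions $(d,s,\varphi)\in\mathbb{LE}_b$ (with first two coordinates exactly $d$ and $s$) such that $\frac{|\varphi(n)|}{b(n)}\leq2^{-n/2^k}$ for all $n\geq|d|$. A subset of a poset is centered if each of its finite subsets has a common lower bound in the poset; a poset is $\sigma$-centered if it is a countable union of centered subsets. *)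

theory Defs
  imports Complex_Main "HOL-Library.Countable_Set" "HOL-Library.Sublist"
begin

text \<open>A poset is given by its carrier \<open>P\<close> and its order \<open>le\<close>. The finite set \<open>F\<close> may be empty.\<close>

definition centered :: "'a set \<Rightarrow> ('a \<Rightarrow> 'a \<Rightarrow> bool) \<Rightarrow> 'a set \<Rightarrow> bool" where
  "centered P le C \<longleftrightarrow>
     C \<subseteq> P \<and> (\<forall>F. finite F \<and> F \<subseteq> C \<longrightarrow> (\<exists>r\<in>P. \<forall>p\<in>F. le r p))"

definition sigma_centered :: "'a set \<Rightarrow> ('a \<Rightarrow> 'a \<Rightarrow> bool) \<Rightarrow> bool" where
  "sigma_centered P le \<longleftrightarrow>
     (\<exists>\<C>. countable \<C> \<and> (\<forall>C\<in>\<C>. centered P le C) \<and> P = \<Union>\<C>)"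

text \<open>Finite sequences are lists, with \<open>True\<close> standing for \<open>1\<close> in \<open>2 = {0, 1}\<close>; the ordinal
  \<open>b n\<close> is \<open>{..<b n}\<close>.\<close>

type_synonym le_triple = "bool list \<times> nat list \<times> (nat \<Rightarrow> nat set)"

definition seqs :: "(nat \<Rightarrow> nat) \<Rightarrow> nat \<Rightarrow> nat list set" where
  "seqs b m = {s. length s = m \<and> (\<forall>n<m. s ! n \<in> {..<b n})}"

definition small_from :: "(nat \<Rightarrow> nat) \<Rightarrow> nat \<Rightarrow> nat \<Rightarrow> (nat \<Rightarrow> nat set) \<Rightarrow> bool" where
  "small_from b k m \<phi> \<longleftrightarrow>
     (\<forall>n\<ge>m. real (card (\<phi> n)) / real (b n) \<le> 2 powr (- (real n / 2 ^ k)))"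

definition LE :: "(nat \<Rightarrow> nat) \<Rightarrow> le_triple set" where
  "LE b = {(d, s, \<phi>). s \<in> seqs b (length d) \<and> (\<forall>n. \<phi> n \<in> Pow {..<b n}) \<and>
                     (\<exists>k. small_from b k (length d) \<phi>)}"

definition ones :: "bool list \<Rightarrow> nat set" where
  "ones d = {n. n < length d \<and> d ! n}"

text \<open>\<open>LE_le p' p\<close> means that \<open>p'\<close> is the stronger condition.\<close>

fun LE_le :: "le_triple \<Rightarrow> le_triple \<Rightarrow> bool" where
  "LE_le (d', s', \<phi>') (d, s, \<phi>) \<longleftrightarrow>
     prefix d d' \<and> prefix s s' \<and> (\<forall>n. \<phi> n \<subseteq> \<phi>' n) \<and>
     (\<forall>n \<in> ones d' - ones d. s' ! n \<notin> \<phi> n)"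

definition Q :: "(nat \<Rightarrow> nat) \<Rightarrow> bool list \<Rightarrow> nat list \<Rightarrow> nat \<Rightarrow> le_triple set" where
  "Q b d s k = {(d', s', \<phi>) \<in> LE b. d' = d \<and> s' = s \<and> small_from b k (length d) \<phi>}"

lemma LE_partial_order:
  "partial_order_on (LE b) {(p, q). p \<in> LE b \<and> q \<in> LE b \<and> LE_le p q}"
proof -
  have refl: "LE_le p p" for p by (cases p) simp
  have trans: "LE_le p r" if mem: "p \<in> LE b" "q \<in> LE b" and le: "LE_le p q" "LE_le q r" for p q r
  proof -
    obtain d s \<phi> d' s' \<phi>' d'' s'' \<phi>''
      where eq: "p = (d, s, \<phi>)" "q = (d', s', \<phi>')" "r = (d'', s'', \<phi>'')"
      by (cases p, cases q, cases r) blast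
    have "s ! n \<notin> \<phi>'' n" if n: "n \<in> ones d - ones d''" for n
    proof (cases "n \<in> ones d'")
      case True
      then have "n < length s'" using mem eq by (auto simp: LE_def seqs_def ones_def)
      then have "s ! n = s' ! n" using le eq by (auto simp: prefix_def nth_append)
      then show ?thesis using True n le eq by auto
    next
      case False
      then have "s ! n \<notin> \<phi>' n" using n le eq by auto
      moreover have "\<phi>'' n \<subseteq> \<phi>' n" using le eq by auto
      ultimately show ?thesis by blast
    qed
    then show ?thesis using le eq by (auto intro: prefix_order.trans) blast
  qed
  have antisym: "p = q" if "LE_le p q" "LE_le q p" for p q
    using that by (cases p, cases q) (auto intro!: prefix_order.antisym ext)
  let ?r = "{(p, q). p \<in> LE b \<and> q \<in> LE b \<and> LE_le p q}"
  have "refl_on (LE b) ?r"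
    using refl by (intro refl_onI) blast
  moreover have "trans ?r"
    using trans by (intro transI) blast
  moreover have "antisym ?r"
    using antisym by (intro antisymI) blast
  ultimately show ?thesis
    unfolding partial_order_on_def preorder_on_def by blast
qed

end

theory Submission imports Defs begin

text \<open>
  Conditions in the same \<open>Q b d s k\<close> differ only in their third coordinate, so the natural lower
  bound of \<open>m\<close> of them takes the pointwise union of these. Subadditivity of cardinality bounds its
  relative size at \<open>n\<close> only by \<open>m * 2 powr (- (n / 2 ^ k))\<close>. Passing from \<open>k\<close> to \<open>k + 1\<close> frees a
  factor \<open>2 powr (n / 2 ^ (k + 1))\<close>, which absorbs \<open>m\<close> once \<open>n \<ge> m * 2 ^ (k + 1)\<close>, because
  \<open>m \<le> 2 ^ m\<close>; this is \<open>small_from_UN\<close>.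

  The finitely many smaller \<open>n\<close>, where the union may be too big, are put below the length of the
  stem: \<open>d\<close> is extended by zeros only. The order restricts the new entries of \<open>s\<close> only where the
  new part of \<open>d\<close> is \<open>1\<close>, so this padding is free, and these entries may be arbitrary, for
  instance \<open>0\<close>.

  There are only countably many triples \<open>(d, s, k)\<close>, and the corresponding sets cover the poset by
  the very definition of a condition, whence \<open>\<sigma>\<close>-centeredness.
\<close>

lemma small_from_UN:
  assumes fin: "finite I"
    and small: "\<And>i. i \<in> I \<Longrightarrow> small_from b k m (\<phi> i)"
    and le: "m \<le> l" "card I * 2 ^ Suc k \<le> l"
  shows "small_from b (Suc k) l (\<lambda>n. \<Union>i\<in>I. \<phi> i n)"
  unfolding small_from_def
proof (intro allI impI)
  fix n assume n: "n \<ge> l"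
  define e where "e = real n / 2 ^ Suc k"
  have two_e: "real n / 2 ^ k = e + e"
    by (simp add: e_def)
  have "real (card I * 2 ^ Suc k) \<le> real n"
    using n le by (intro of_nat_mono) linarith
  then have "real (card I) \<le> e"
    by (simp add: e_def pos_le_divide_eq)
  have "real (card I) \<le> 2 ^ card I"
    by (rule less_imp_le[OF of_nat_less_two_power])
  also have "\<dots> = 2 powr real (card I)"
    by (simp add: powr_realpow)
  also have "\<dots> \<le> 2 powr e"
    using \<open>real (card I) \<le> e\<close> by (intro powr_mono) auto
  finally have card_I: "real (card I) \<le> 2 powr e" .
  have "real (card (\<Union>i\<in>I. \<phi> i n)) \<le> (\<Sum>i\<in>I. real (card (\<phi> i n)))"
    using of_nat_mono[OF card_UN_le[OF fin, of "\<lambda>i. \<phi> i n"], where 'a = real] by simp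
  then have "real (card (\<Union>i\<in>I. \<phi> i n)) / real (b n) \<le> (\<Sum>i\<in>I. real (card (\<phi> i n)) / real (b n))"
    by (simp add: divide_right_mono flip: sum_divide_distrib)
  also have "\<dots> \<le> real (card I) * 2 powr (- (e + e))"
    using small n le by (intro sum_bounded_above) (auto simp: small_from_def simp flip: two_e)
  also have "\<dots> \<le> 2 powr e * 2 powr (- (e + e))"
    using card_I by (intro mult_right_mono) auto
  also have "\<dots> = 2 powr (- e)"
    by (simp flip: powr_add)
  finally show "real (card (\<Union>i\<in>I. \<phi> i n)) / real (b n) \<le> 2 powr (- (real n / 2 ^ Suc k))"
    by (simp add: e_def)
qed

lemma ones_append_False: "ones (d @ replicate j False) = ones d"
proof -
  have "n < length d" if "n < length d + j" "replicate j False ! (n - length d)" for n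
  proof (rule ccontr)
    assume "\<not> n < length d"
    then have "n - length d < j"
      using that(1) by linarith
    then show False
      using that(2) by simp
  qed
  then show ?thesis
    by (auto simp: ones_def nth_append)
qed

lemma seqs_append_0:
  assumes "\<And>n. b n > 0" and "s \<in> seqs b m"
  shows "s @ replicate j 0 \<in> seqs b (m + j)"
  using assms by (auto simp: seqs_def nth_append)

text \<open>Positivity of \<open>b\<close> is what allows \<open>s\<close> to be prolonged along with \<open>d\<close>.\<close>

lemma centered_Q:
  assumes pos: "\<And>n. b n > 0" and s: "s \<in> seqs b (length d)"
  shows "centered (LE b) LE_le (Q b d s k)"
  unfolding centered_def
proof (intro conjI allI impI)
  show "Q b d s k \<subseteq> LE b"
    by (auto simp: Q_def)
next
  fix F assume F: "finite F \<and> F \<subseteq> Q b d s k"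
  define j where "j = card F * 2 ^ Suc k"
  define \<psi> where "\<psi> = (\<lambda>n. \<Union>p\<in>F. snd (snd p) n)"
  define r where "r = (d @ replicate j False, s @ replicate j 0, \<psi>)"
  have "small_from b (Suc k) (length d + j) \<psi>"
    unfolding \<psi>_def
    using F by (intro small_from_UN[where m = "length d"]) (auto simp: Q_def j_def)
  moreover have "\<psi> n \<subseteq> {..<b n}" for n
    unfolding \<psi>_def using F by (fastforce simp: Q_def LE_def)
  ultimately have "r \<in> LE b"
    using seqs_append_0[OF pos s, of j] by (auto simp: r_def LE_def)
  moreover have "LE_le r p" if "p \<in> F" for p
  proof -
    have "p \<in> Q b d s k"
      using F that by blast
    then obtain \<phi> where p: "p = (d, s, \<phi>)"
      by (auto simp: Q_def)
    have "\<phi> n \<subseteq> \<psi> n" for n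
      using that by (force simp: \<psi>_def p)
    then show ?thesis
      by (simp add: r_def p ones_append_False)
  qed
  ultimately show "\<exists>r\<in>LE b. \<forall>p\<in>F. LE_le r p"
    by blast
qed

lemma LE_eq_Union_Q:
  "LE b = \<Union> ((\<lambda>(d, s, k). Q b d s k) ` {(d, s, k). s \<in> seqs b (length d)})"
  by (fastforce simp: LE_def Q_def)

theorem lemma4p27:
  fixes b :: "nat \<Rightarrow> nat"
  assumes "\<And>n. b n \<ge> 2 ^ n"
  shows "(\<forall>d s k. s \<in> seqs b (length d) \<longrightarrow> centered (LE b) LE_le (Q b d s k)) \<and>
         sigma_centered (LE b) LE_le"
proof -
  have pos: "b n > 0" for n
    using assms[of n] by (rule less_le_trans[rotated]) simp
  define \<C> where "\<C> = (\<lambda>(d, s, k). Q b d s k) ` {(d, s, k). s \<in> seqs b (length d)}"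
  have "countable \<C>"
    unfolding \<C>_def by (intro countable_image countableI_type)
  moreover have "\<forall>C\<in>\<C>. centered (LE b) LE_le C"
    unfolding \<C>_def using centered_Q[of b, OF pos] by auto
  moreover have "LE b = \<Union>\<C>"
    unfolding \<C>_def by (rule LE_eq_Union_Q)
  ultimately have "sigma_centered (LE b) LE_le"
    unfolding sigma_centered_def by blast
  then show ?thesis
    using centered_Q[of b, OF pos] by blast
qed

end
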